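(* Let $\mathcal{F}=(S,\sqsubseteq,P)$ be a possibility frame in which every principal downset $\mathord{\downarrow}x$ ($x\in S$) belongs to $P$, and let $B$ be a Boolean algebra isomorphic to the Boolean algebra $P$. Then for any $\mathcal{T}$-BAO $\mathbb{B}=(B,\{\Box_i\}_{i\in I})$ there is a strong relational possibility frame $\mathbb{B}_\mathcal{F}=(S,\sqsubseteq,P,\{R_i\}_{i\in I})$ such that $(\mathbb{B}_\mathcal{F})^\mathsf{b}$ is isomorphic to $\mathbb{B}$.
   Context: For a poset $(S,\sqsubseteq)$, $\mathord{\downarrow}x=\{y\mid y\sqsubseteq x\}$ and $\mathcal{RO}(S,\sqsubseteq)$ is the complete Boolean algebra (under inclusion) of $U=\{x\mid\forall x'\sqsubseteq x\ \exists x''\sqsubseteq x':x''\in U\}$, with $\neg U=\{x\mid\forall x'\sqsubseteq x\ x'\notin U\}$ and meet $\cap$. A possibility frame is $(S,\sqsubseteq,P)$ with $\varnothing\ne P\subseteq\mathcal{RO}(S,\sqsubseteq)$ closed under $\neg,\cap$ (a Boolean subalgebra). A relational possibility frame is $(S,\sqsubseteq,P,\{R_i\}_{i\in I})$ with $(S,\sqsubseteq,P)$ a possibility frame, $R_i$ binary relations on $S$, and $P$ closed under $\Box_iZ=\{x\mid R_i(x)\subseteq Z\}$, $R_i(x)=\{y\mid xR_iy\}$; its algebra $(\cdot)^\mathsf{b}$ is $(P,\{\Box_i\}_{i\in I})$. It is strong if each $R_i$ satisfies: up-$R$ (if $x'\sqsubseteq x$ and $x'R_iy'$ then $xR_iy'$);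 $R$-down (if $xR_iy$ and $y'\sqsubseteq y$ then $xR_iy'$); $R$-refinability (if $xR_iy$ then $\exists x'\sqsubseteq x\ \forall x''\sqsubseteq x'\ \exists y'\sqsubseteq y: x''R_iy'$); $R$-dense ($xR_iy$ whenever $\forall y'\sqsubseteq y\ \exists y''\sqsubseteq y': xR_iy''$). A BAO is a Boolean algebra with operations $\Box_i$ preserving finite meets (including the top); it is a $\mathcal{T}$-BAO if each $\Box_i$ has a residual $f_i:B\to B$, i.e., $a\leq\Box_ib$ iff $f_i(a)\leq b$ for all $a,b$. BAO isomorphisms are Boolean isomorphisms commuting with each $\Box_i$. *)

theory Defs
  imports Main
begin

text \<open>A poset is a carrier \<open>S\<close> with a relation \<open>r\<close> such that \<open>partial_order_on S r\<close>; \<open>(y, x) \<in> r\<close> reads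
  \<open>y\<close> refines \<open>x\<close>, and the principal downset of \<open>x\<close> is \<open>under r x\<close>.\<close>

definition regular_opens :: "'s set \<Rightarrow> 's rel \<Rightarrow> 's set set" where
  "regular_opens S r =
     {U. U = {x \<in> S. \<forall>x'\<in>under r x. \<exists>x''\<in>under r x'. x'' \<in> U}}"

definition ro_neg :: "'s set \<Rightarrow> 's rel \<Rightarrow> 's set \<Rightarrow> 's set" where
  "ro_neg S r U = {x \<in> S. \<forall>x'\<in>under r x. x' \<notin> U}"

definition ro_join :: "'s set \<Rightarrow> 's rel \<Rightarrow> 's set \<Rightarrow> 's set \<Rightarrow> 's set" where
  "ro_join S r U V = ro_neg S r (ro_neg S r U \<inter> ro_neg S r V)"

locale possibility_frame =
  fixes S :: "'s set" and r :: "'s rel" and P :: "'s set set"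
  assumes poset: "partial_order_on S r"
    and nonempty: "P \<noteq> {}"
    and regular_open: "P \<subseteq> regular_opens S r"
    and neg_closed: "U \<in> P \<Longrightarrow> ro_neg S r U \<in> P"
    and inter_closed: "U \<in> P \<Longrightarrow> V \<in> P \<Longrightarrow> U \<inter> V \<in> P"

definition rel_box :: "'s set \<Rightarrow> 's rel \<Rightarrow> 's set \<Rightarrow> 's set" where
  "rel_box S Q Z = {x \<in> S. Q `` {x} \<subseteq> Z}"

text \<open>The modalities are indexed by a set \<open>I\<close>, which may be empty; nothing is required of \<open>R i\<close> for \<open>i \<notin> I\<close>.\<close>

locale relational_possibility_frame = possibility_frame S r P
  for S :: "'s set" and r :: "'s rel" and P :: "'s set set" +
  fixes I :: "'i set" and R :: "'i \<Rightarrow> 's rel"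
  assumes rel_on: "i \<in> I \<Longrightarrow> R i \<subseteq> S \<times> S"
    and box_closed: "i \<in> I \<Longrightarrow> Z \<in> P \<Longrightarrow> rel_box S (R i) Z \<in> P"

definition up_R :: "'s rel \<Rightarrow> 's rel \<Rightarrow> bool" where
  "up_R r Q \<longleftrightarrow> (\<forall>x x' y'. (x', x) \<in> r \<and> (x', y') \<in> Q \<longrightarrow> (x, y') \<in> Q)"

definition R_down :: "'s rel \<Rightarrow> 's rel \<Rightarrow> bool" where
  "R_down r Q \<longleftrightarrow> (\<forall>x y y'. (x, y) \<in> Q \<and> (y', y) \<in> r \<longrightarrow> (x, y') \<in> Q)"

definition R_refinability :: "'s rel \<Rightarrow> 's rel \<Rightarrow> bool" where
  "R_refinability r Q \<longleftrightarrow>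
     (\<forall>x y. (x, y) \<in> Q \<longrightarrow>
        (\<exists>x'\<in>under r x. \<forall>x''\<in>under r x'. \<exists>y'\<in>under r y. (x'', y') \<in> Q))"

definition R_dense :: "'s set \<Rightarrow> 's rel \<Rightarrow> 's rel \<Rightarrow> bool" where
  "R_dense S r Q \<longleftrightarrow>
     (\<forall>x\<in>S. \<forall>y\<in>S. (\<forall>y'\<in>under r y. \<exists>y''\<in>under r y'. (x, y'') \<in> Q) \<longrightarrow> (x, y) \<in> Q)"

locale strong_relational_possibility_frame = relational_possibility_frame S r P I R
  for S :: "'s set" and r :: "'s rel" and P :: "'s set set"
    and I :: "'i set" and R :: "'i \<Rightarrow> 's rel" +
  assumes up_R: "i \<in> I \<Longrightarrow> up_R r (R i)"
    and R_down: "i \<in> I \<Longrightarrow> R_down r (R i)"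
    and R_refinability: "i \<in> I \<Longrightarrow> R_refinability r (R i)"
    and R_dense: "i \<in> I \<Longrightarrow> R_dense S r (R i)"

text \<open>The underlying Boolean algebra of a BAO is the whole type \<open>'b\<close>. The class
  \<^class>\<open>boolean_algebra\<close> does not exclude the one-element algebra.\<close>

locale bao =
  fixes I :: "'i set" and box :: "'i \<Rightarrow> 'b::boolean_algebra \<Rightarrow> 'b"
  assumes box_top: "i \<in> I \<Longrightarrow> box i top = top"
    and box_inf: "i \<in> I \<Longrightarrow> box i (inf a b) = inf (box i a) (box i b)"

locale t_bao = bao I box
  for I :: "'i set" and box :: "'i \<Rightarrow> 'b::boolean_algebra \<Rightarrow> 'b" +
  assumes residual: "i \<in> I \<Longrightarrow> \<exists>f. \<forall>a b. a \<le> box i b \<longleftrightarrow> f a \<le> b"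

definition boolean_iso ::
    "'s set \<Rightarrow> 's rel \<Rightarrow> 's set set \<Rightarrow> ('b::boolean_algebra \<Rightarrow> 's set) \<Rightarrow> bool" where
  "boolean_iso S r P h \<longleftrightarrow>
     bij_betw h UNIV P \<and>
     h bot = {} \<and> h top = S \<and>
     (\<forall>a. h (- a) = ro_neg S r (h a)) \<and>
     (\<forall>a b. h (inf a b) = h a \<inter> h b) \<and>
     (\<forall>a b. h (sup a b) = ro_join S r (h a) (h b))"

text \<open>\<open>h\<close> is an isomorphism from the BAO \<open>('b, box)\<close> onto the algebra
  \<open>(P, \<lambda>i. rel_box S (R i))\<close> of the relational possibility frame \<open>(S, r, P, R)\<close>.\<close>

definition frame_bao_iso ::
    "'s set \<Rightarrow> 's rel \<Rightarrow> 's set set \<Rightarrow> 'i set \<Rightarrow> ('i \<Rightarrow> 's rel) \<Rightarrow>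
     ('i \<Rightarrow> 'b::boolean_algebra \<Rightarrow> 'b) \<Rightarrow> ('b \<Rightarrow> 's set) \<Rightarrow> bool" where
  "frame_bao_iso S r P I R box h \<longleftrightarrow>
     boolean_iso S r P h \<and> (\<forall>i\<in>I. \<forall>a. h (box i a) = rel_box S (R i) (h a))"

end

theory Submission
  imports Defs
begin

text \<open>Let \<open>h\<close> be the given isomorphism, \<open>d x\<close> the element with \<open>h (d x) = \<down>x\<close>, and \<open>f\<close> a residual of \<open>\<box>\<close>.
  The relation is \<open>x R y \<longleftrightarrow> y \<in> h (f (d x))\<close>. Then \<open>R(x) \<subseteq> h b\<close> iff \<open>f (d x) \<le> b\<close> iff \<open>d x \<le> \<box> b\<close>
  iff \<open>x \<in> h (\<box> b)\<close>, so \<open>h\<close> commutes with the modalities. Refinability follows because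
  \<open>h (\<box> (- d y))\<close> is regular open and consists of those \<open>x\<close> that see no refinement of \<open>y\<close>.\<close>

lemma regular_opens_memI:
  assumes "U \<in> regular_opens S r" "x \<in> S"
    and "\<And>x'. x' \<in> under r x \<Longrightarrow> \<exists>x''\<in>under r x'. x'' \<in> U"
  shows "x \<in> U"
  using assms unfolding regular_opens_def by blast

lemma regular_opens_subset: "U \<in> regular_opens S r \<Longrightarrow> U \<subseteq> S"
  unfolding regular_opens_def by blast

text \<open>The condition for \<open>x\<close> to lie in \<open>U\<close> quantifies over all
  refinements of \<open>x\<close>, and by transitivity those include every refinement of
  \<open>x'\<close>.\<close>

lemma regular_opens_downward:
  assumes "partial_order_on S r" "U \<in> regular_opens S r" "x \<in> U" "(x', x) \<in> r"
  shows "x' \<in> U"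
proof -
  have "trans r" "x' \<in> S"
    using assms by (auto simp: partial_order_on_def preorder_on_def)
  moreover have "\<forall>y\<in>under r x. \<exists>z\<in>under r y. z \<in> U"
    using assms(2,3) unfolding regular_opens_def by blast
  ultimately show ?thesis
    using assms(4) by (intro regular_opens_memI[OF assms(2)]) (auto simp: under_def dest: transD)
qed

text \<open>Both orders are definable from meets, \<open>a\<close> being below \<open>b\<close> iff
  \<open>inf a b = a\<close>, and an injective \<open>h\<close> that preserves meets reflects this
  equation.\<close>

lemma boolean_iso_subset_iff:
  assumes "boolean_iso S r P h"
  shows "h a \<subseteq> h b \<longleftrightarrow> a \<le> b"
proof -
  have "inj h" and "h (inf a b) = h a \<inter> h b"
    using assms by (auto simp: boolean_iso_def bij_betw_def)
  then show ?thesis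
    by (metis inf.absorb_iff1 inj_eq)
qed

locale principal_iso = possibility_frame S r P
  for S :: "'s set" and r :: "'s rel" and P :: "'s set set" +
  fixes h :: "'b::boolean_algebra \<Rightarrow> 's set"
  assumes iso: "boolean_iso S r P h"
    and principal: "x \<in> S \<Longrightarrow> under r x \<in> P"
begin

definition d :: "'s \<Rightarrow> 'b" where
  "d x = inv h (under r x)"

definition residual_rel :: "('b \<Rightarrow> 'b) \<Rightarrow> 's rel" where
  "residual_rel f = {(x, y). x \<in> S \<and> y \<in> h (f (d x))}"

lemma h_d: "x \<in> S \<Longrightarrow> h (d x) = under r x"
  using iso principal unfolding d_def boolean_iso_def bij_betw_def
  by (metis f_inv_into_f)

lemma h_in_P: "h a \<in> P"
  using iso by (auto simp: boolean_iso_def bij_betw_def)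

lemma P_eq_range: "P = range h"
  using iso by (simp add: boolean_iso_def bij_betw_def)

lemma h_regular: "h a \<in> regular_opens S r"
  using h_in_P regular_open by blast

lemma h_subset: "h a \<subseteq> S"
  using h_regular by (rule regular_opens_subset)

lemma h_downward: "x \<in> h a \<Longrightarrow> (x', x) \<in> r \<Longrightarrow> x' \<in> h a"
  using regular_opens_downward[OF poset h_regular] .

lemma r_in_S: "(x, y) \<in> r \<Longrightarrow> x \<in> S \<and> y \<in> S"
  using poset by (auto simp: partial_order_on_def preorder_on_def)

lemma r_refl: "x \<in> S \<Longrightarrow> (x, x) \<in> r"
  using poset by (auto simp: partial_order_on_def preorder_on_def refl_on_def)

text \<open>A downset contains \<open>x\<close> iff it contains \<open>under r x\<close>, which is
  \<open>h (d x)\<close>. This turns membership of points into inequalities of the algebra, where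
  the residual applies.\<close>

lemma d_le_iff:
  assumes "x \<in> S"
  shows "d x \<le> a \<longleftrightarrow> x \<in> h a"
proof -
  have "d x \<le> a \<longleftrightarrow> under r x \<subseteq> h a"
    using assms by (simp add: boolean_iso_subset_iff[OF iso, symmetric] h_d)
  also have "\<dots> \<longleftrightarrow> x \<in> h a"
    using assms by (auto simp: under_def intro: r_refl h_downward)
  finally show ?thesis .
qed

lemma le_uminus_d_iff:
  assumes "y \<in> S"
  shows "a \<le> - d y \<longleftrightarrow> (\<forall>y'\<in>under r y. y' \<notin> h a)"
proof -
  have "a \<le> - d y \<longleftrightarrow> d y \<le> - a"
    by (metis compl_le_swap1)
  also have "\<dots> \<longleftrightarrow> y \<in> ro_neg S r (h a)"
    using iso assms by (simp add: d_le_iff boolean_iso_def)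
  finally show ?thesis
    using assms by (simp add: ro_neg_def)
qed

lemma R_down_residual_rel: "R_down r (residual_rel f)"
  using h_downward by (auto simp: R_down_def residual_rel_def)

text \<open>For fixed \<open>x\<close> in \<open>S\<close> the successors form
  \<open>h (f (d x))\<close>, and density is the membership condition of this regular open
  set.\<close>

lemma R_dense_residual_rel: "R_dense S r (residual_rel f)"
  unfolding R_dense_def residual_rel_def
  by (auto intro: regular_opens_memI[OF h_regular])

context
  fixes bx f :: "'b \<Rightarrow> 'b"
  assumes residual: "\<And>a b. a \<le> bx b \<longleftrightarrow> f a \<le> b"
begin

text \<open>Taking \<open>f b\<close> on the right of the adjunction gives
  \<open>b \<le> bx (f b)\<close>, so \<open>a \<le> b\<close> yields
  \<open>a \<le> bx (f b)\<close>.\<close>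

lemma residual_mono: "a \<le> b \<Longrightarrow> f a \<le> f b"
  by (metis residual order_refl order_trans)

lemma rel_box_residual_rel: "rel_box S (residual_rel f) (h b) = h (bx b)"
proof -
  have "residual_rel f `` {x} \<subseteq> h b \<longleftrightarrow> x \<in> h (bx b)" if "x \<in> S" for x
  proof -
    have "residual_rel f `` {x} = h (f (d x))"
      using that by (auto simp: residual_rel_def)
    then show ?thesis
      using that by (simp add: boolean_iso_subset_iff[OF iso] flip: residual d_le_iff)
  qed
  then show ?thesis
    using h_subset by (auto simp: rel_box_def)
qed

text \<open>Refining a point lowers its \<open>d\<close>, so by monotonicity of \<open>f\<close> it
  can only lose successors.\<close>

lemma up_R_residual_rel: "up_R r (residual_rel f)"
  unfolding up_R_def
proof (intro allI impI)
  fix x x' y'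
  assume *: "(x', x) \<in> r \<and> (x', y') \<in> residual_rel f"
  then have S: "x \<in> S" "x' \<in> S"
    using r_in_S by blast+
  then have "d x' \<le> d x"
    using * by (simp add: d_le_iff h_d under_def)
  then have "h (f (d x')) \<subseteq> h (f (d x))"
    by (simp add: boolean_iso_subset_iff[OF iso] residual_mono)
  then show "(x, y') \<in> residual_rel f"
    using * S by (auto simp: residual_rel_def)
qed

lemma R_refinability_residual_rel: "R_refinability r (residual_rel f)"
  unfolding R_refinability_def
proof (intro allI impI, rule ccontr)
  fix x y
  assume xy: "(x, y) \<in> residual_rel f"
    and neg: "\<not> (\<exists>x'\<in>under r x. \<forall>x''\<in>under r x'. \<exists>y'\<in>under r y. (x'', y') \<in> residual_rel f)"
  have S: "x \<in> S" "y \<in> S"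
    using xy h_subset by (auto simp: residual_rel_def)
  \<comment> \<open>The left side says \<open>d z \<le> bx (- d y)\<close>, that is,
    \<open>f (d z) \<le> - d y\<close>: the successor set of \<open>z\<close> avoids every
    refinement of \<open>y\<close>.\<close>
  have sees_none: "z \<in> h (bx (- d y)) \<longleftrightarrow> (\<forall>y'\<in>under r y. (z, y') \<notin> residual_rel f)"
    if "z \<in> S" for z
    using that S by (simp add: residual_rel_def residual le_uminus_d_iff flip: d_le_iff)
  \<comment> \<open>The negated refinability says that below every refinement of \<open>x\<close>
    some point sees no refinement of \<open>y\<close>; regular openness passes this on to
    \<open>x\<close>.\<close>
  have "x \<in> h (bx (- d y))"
  proof (rule regular_opens_memI[OF h_regular S(1)])
    fix x' assume "x' \<in> under r x"
    then obtain x'' where x'': "x'' \<in> under r x'"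
      and "\<forall>y'\<in>under r y. (x'', y') \<notin> residual_rel f"
      using neg by blast
    moreover have "x'' \<in> S"
      using x'' r_in_S by (auto simp: under_def)
    ultimately show "\<exists>x''\<in>under r x'. x'' \<in> h (bx (- d y))"
      using sees_none by blast
  qed
  \<comment> \<open>By reflexivity \<open>y\<close> is one of its own refinements, and
    \<open>x\<close> sees it.\<close>
  then show False
    using sees_none[OF S(1)] xy r_refl[OF S(2)] by (auto simp: under_def)
qed

end

end

theorem theorem5p3p25:
  fixes S :: "'s set" and r :: "'s rel" and P :: "'s set set"
    and I :: "'i set" and box :: "'i \<Rightarrow> 'b::boolean_algebra \<Rightarrow> 'b"
  assumes "possibility_frame S r P"
    and "\<forall>x\<in>S. under r x \<in> P"
    and "\<exists>h :: 'b \<Rightarrow> 's set. boolean_iso S r P h"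
    and "t_bao I box"
  shows "\<exists>R :: 'i \<Rightarrow> 's rel.
           strong_relational_possibility_frame S r P I R \<and>
           (\<exists>h :: 'b \<Rightarrow> 's set. frame_bao_iso S r P I R box h)"
proof -
  obtain h :: "'b \<Rightarrow> 's set" where iso: "boolean_iso S r P h"
    using assms(3) by blast
  interpret principal_iso S r P h
    using assms(1,2) iso by (simp add: principal_iso_def principal_iso_axioms_def)
  \<comment> \<open>One residual is chosen for each index in \<open>I\<close>; at other indices
    \<open>f i\<close> is arbitrary, where the frame leaves \<open>R i\<close>
    unconstrained.\<close>
  obtain f where f: "\<And>i a b. i \<in> I \<Longrightarrow> a \<le> box i b \<longleftrightarrow> f i a \<le> b"
    using t_bao.residual[OF assms(4)] by metis
  define R where "R i = residual_rel (f i)" for i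
  have box: "rel_box S (R i) (h a) = h (box i a)" if "i \<in> I" for i a
    unfolding R_def using f[OF that] by (rule rel_box_residual_rel)
  have "strong_relational_possibility_frame S r P I R"
  proof
    fix i assume i: "i \<in> I"
    show "R i \<subseteq> S \<times> S"
      using h_subset by (auto simp: R_def residual_rel_def)
    show "rel_box S (R i) Z \<in> P" if "Z \<in> P" for Z
      using that box[OF i] by (auto simp: P_eq_range)
    show "up_R r (R i)"
      unfolding R_def using f[OF i] by (rule up_R_residual_rel)
    show "R_down r (R i)"
      unfolding R_def by (rule R_down_residual_rel)
    show "R_refinability r (R i)"
      unfolding R_def using f[OF i] by (rule R_refinability_residual_rel)
    show "R_dense S r (R i)"
      unfolding R_def by (rule R_dense_residual_rel)
  qed
  moreover have "frame_bao_iso S r P I R box h"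
    using iso box by (simp add: frame_bao_iso_def)
  ultimately show ?thesis
    by blast
qed

end
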